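(* Let $h\in C^\infty(\mathbb{R})$ and let $M_h\colon C^\infty(\mathbb{R})\to C^\infty(\mathbb{R})$, $M_hf=hf$. Then: (1) $M_h\colon C^\infty(\mathbb{R})\to C^\infty(\mathbb{R})$ is power bounded if and only if $\{h^n\}_{n\in\mathbb{N}}$ is a bounded sequence in $C^\infty(\mathbb{R})$. (2) $M_h\colon C^\infty(\mathbb{R})\to C^\infty(\mathbb{R})$ is mean ergodic if and only if $\{h_{[n]}\}_{n\in\mathbb{N}}$ is a convergent sequence in $C^\infty(\mathbb{R})$, where $h_{[n]}:=\frac1n\sum_{m=1}^nh^m$ (pointwise powers).
   Context: Functions are complex-valued. $C^\infty(\mathbb{R})$ carries its usual Fréchet topology, generated by the seminorms $\sup_{x\in K}\sup_{0\le i\le m}|f^{(i)}(x)|$, $K\subset\mathbb{R}$ compact, $m\in\mathbb{N}$. For a locally convex Hausdorff space $E$, $\mathcal{L}(E)$ is the space of continuous linear operators on $E$. $T\in\mathcal{L}(E)$ is power bounded if $\{T^n\}_{n\in\mathbb{N}}$ is equicontinuous in $\mathcal{L}(E)$; $T$ is mean ergodic if its Cesàro means $T_{[n]}=\frac1n\sum_{m=1}^nT^m$, $n\in\mathbb{N}$, converge in $\mathcal{L}(E)$ with respect to the strong operator topology (pointwise convergence on $E$), the limit being in $\mathcal{L}(E)$. *)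

theory Defs
  imports "HOL-Analysis.Analysis" "HOL-Library.Function_Algebras"
begin

text \<open>
  A locally convex space is given by a topology \<open>X\<close>, whose carrier is \<^term>\<open>topspace X\<close>,
  together with a complex scalar multiplication \<open>sc\<close>; addition and zero come from the ambient type.
\<close>

definition seminorm_topology :: "'a::ab_group_add set \<Rightarrow> ('a \<Rightarrow> real) set \<Rightarrow> 'a topology" where
  "seminorm_topology S P =
     topology_generated_by {{g \<in> S. p (g - f) < r} | p f r. p \<in> P \<and> f \<in> S \<and> r > 0}"

definition continuous_operators ::
    "(complex \<Rightarrow> 'a \<Rightarrow> 'a) \<Rightarrow> 'a::ab_group_add topology \<Rightarrow> ('a \<Rightarrow> 'a) set" where
  "continuous_operators sc X =
     {T. continuous_map X X T \<and>
         (\<forall>f \<in> topspace X. \<forall>g \<in> topspace X. T (f + g) = T f + T g) \<and>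
         (\<forall>c. \<forall>f \<in> topspace X. T (sc c f) = sc c (T f))}"

text \<open>For linear operators, equicontinuity is equivalent to equicontinuity at the origin.\<close>

definition equicontinuous_family ::
    "'a::ab_group_add topology \<Rightarrow> ('a \<Rightarrow> 'a) set \<Rightarrow> bool" where
  "equicontinuous_family X H \<longleftrightarrow>
     (\<forall>U. openin X U \<and> 0 \<in> U \<longrightarrow>
        (\<exists>V. openin X V \<and> 0 \<in> V \<and> (\<forall>T \<in> H. T ` V \<subseteq> U)))"

definition power_bounded ::
    "(complex \<Rightarrow> 'a \<Rightarrow> 'a) \<Rightarrow> 'a::ab_group_add topology \<Rightarrow> ('a \<Rightarrow> 'a) \<Rightarrow> bool" where
  "power_bounded sc X T \<longleftrightarrow>
     T \<in> continuous_operators sc X \<and> equicontinuous_family X {T ^^ n | n. n \<ge> 1}"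

definition cesaro_mean ::
    "(complex \<Rightarrow> 'a \<Rightarrow> 'a) \<Rightarrow> ('a::ab_group_add \<Rightarrow> 'a) \<Rightarrow> nat \<Rightarrow> 'a \<Rightarrow> 'a" where
  "cesaro_mean sc T n f = sc (1 / of_nat n) (\<Sum>m = 1..n. (T ^^ m) f)"

definition mean_ergodic ::
    "(complex \<Rightarrow> 'a \<Rightarrow> 'a) \<Rightarrow> 'a::ab_group_add topology \<Rightarrow> ('a \<Rightarrow> 'a) \<Rightarrow> bool" where
  "mean_ergodic sc X T \<longleftrightarrow>
     T \<in> continuous_operators sc X \<and>
     (\<exists>P \<in> continuous_operators sc X. \<forall>f \<in> topspace X.
        limitin X (\<lambda>n. cesaro_mean sc T n f) (P f) sequentially)"

text \<open>Boundedness in the sense of von Neumann: every neighbourhood of zero absorbs \<open>B\<close>.\<close>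

definition vn_bounded ::
    "(complex \<Rightarrow> 'a \<Rightarrow> 'a) \<Rightarrow> 'a::ab_group_add topology \<Rightarrow> 'a set \<Rightarrow> bool" where
  "vn_bounded sc X B \<longleftrightarrow>
     (\<forall>U. openin X U \<and> 0 \<in> U \<longrightarrow>
        (\<exists>s>0. \<forall>t>s. B \<subseteq> sc (complex_of_real t) ` U))"

definition nth_derivative :: "nat \<Rightarrow> (real \<Rightarrow> complex) \<Rightarrow> real \<Rightarrow> complex" where
  "nth_derivative i = (\<lambda>f x. vector_derivative f (at x)) ^^ i"

definition C_infinity :: "(real \<Rightarrow> complex) set" where
  "C_infinity = {f. \<forall>i x. nth_derivative i f differentiable (at x)}"

text \<open>The supremum over the empty set is unspecified, hence \<open>K \<noteq> {}\<close> in \<open>C_infinity_top\<close>.\<close>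

definition C_infinity_seminorm :: "real set \<Rightarrow> nat \<Rightarrow> (real \<Rightarrow> complex) \<Rightarrow> real" where
  "C_infinity_seminorm K m f = (SUP x\<in>K. SUP i\<in>{0..m}. cmod (nth_derivative i f x))"

definition C_infinity_top :: "(real \<Rightarrow> complex) topology" where
  "C_infinity_top =
     seminorm_topology C_infinity {C_infinity_seminorm K m | K m. compact K \<and> K \<noteq> {}}"

lemma topspace_C_infinity_top: "topspace C_infinity_top = C_infinity"
proof -
  have "f \<in> topspace C_infinity_top" if "f \<in> C_infinity" for f
  proof -
    let ?p = "C_infinity_seminorm {0} 0"
    let ?r = "\<bar>?p (f - f)\<bar> + 1"
    have "f \<in> {g \<in> C_infinity. ?p (g - f) < ?r}"
      using that by auto
    moreover have "{g \<in> C_infinity. ?p (g - f) < ?r} \<in> 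
        {{g \<in> C_infinity. p (g - f) < r} | p f r.
           p \<in> {C_infinity_seminorm K m | K m. compact K \<and> K \<noteq> {}} \<and> f \<in> C_infinity \<and> r > 0}"
      using that by (intro CollectI exI[of _ ?p] exI[of _ f] exI[of _ ?r] conjI) 
        (auto intro!: exI[of _ "{0}"] exI[of _ 0])
    ultimately show ?thesis
      unfolding C_infinity_top_def seminorm_topology_def topology_generated_by_topspace
      by (rule UnionI[rotated])
  qed
  then show ?thesis
    by (auto simp: C_infinity_top_def seminorm_topology_def topology_generated_by_topspace)
qed

definition fun_scale :: "complex \<Rightarrow> (real \<Rightarrow> complex) \<Rightarrow> real \<Rightarrow> complex" where
  "fun_scale c f = (\<lambda>x. c * f x)"

definition mult_operator :: "(real \<Rightarrow> complex) \<Rightarrow> (real \<Rightarrow> complex) \<Rightarrow> real \<Rightarrow> complex" where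
  "mult_operator h f = (\<lambda>x. h x * f x)"

end

theory Submission
  imports Defs
begin

text \<open>
  Everything rests on two observations. First, \<open>C\<^sup>\<infinity>\<close> is a topological algebra: by Leibniz' rule the
  seminorms satisfy \<open>p\<^sub>K\<^sub>,\<^sub>m (f g) \<le> 2\<^sup>m p\<^sub>K\<^sub>,\<^sub>m f p\<^sub>K\<^sub>,\<^sub>m g\<close>. Second, the powers and the
  Cesaro means of \<open>M\<^sub>h\<close> are multiplication by \<open>h\<^sup>n\<close> and by \<open>h\<^sub>[\<^sub>n\<^sub>]\<close>. Hence
  properties of these functions pass to the operators by submultiplicativity, and back by evaluating
  the operators at the constant function \<open>1\<close>.
\<close>

subsection \<open>The algebra of smooth functions\<close>

lemma nth_derivative_0 [simp]: "nth_derivative 0 f = f"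
  by (simp add: nth_derivative_def)

lemma nth_derivative_Suc:
  "nth_derivative (Suc i) f x = vector_derivative (nth_derivative i f) (at x)"
  by (simp add: nth_derivative_def)

text \<open>Peels off the innermost derivative instead of the outermost one, so that an induction on
  the order can pass from \<open>f\<close> to its derivative.\<close>

lemma nth_derivative_Suc':
  "nth_derivative (Suc i) f = nth_derivative i (\<lambda>x. vector_derivative f (at x))"
  by (simp add: nth_derivative_def funpow_Suc_right del: funpow.simps)

lemma C_infinity_differentiable: "f \<in> C_infinity \<Longrightarrow> nth_derivative i f differentiable (at x)"
  by (simp add: C_infinity_def)

lemma C_infinity_differentiable_0: "f \<in> C_infinity \<Longrightarrow> f differentiable (at x)"
  using C_infinity_differentiable[of f 0] by simp

lemma C_infinity_vector_derivative:
  assumes "f \<in> C_infinity"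
  shows "(\<lambda>x. vector_derivative f (at x)) \<in> C_infinity"
  unfolding C_infinity_def
  by (simp flip: nth_derivative_Suc' add: C_infinity_differentiable[OF assms])

text \<open>Differentiability is assumed only below order \<open>i\<close>, and not membership in
  \<open>C_infinity\<close>: the proof that products are smooth applies this to summands whose
  smoothness is still being established order by order.\<close>

lemma nth_derivative_add:
  assumes "\<And>j x. j < i \<Longrightarrow> nth_derivative j f differentiable (at x)"
    and "\<And>j x. j < i \<Longrightarrow> nth_derivative j g differentiable (at x)"
  shows "nth_derivative i (f + g) = nth_derivative i f + nth_derivative i g"
  using assms
proof (induction i)
  case (Suc i)
  show ?case
  proof
    fix x
    have "((\<lambda>y. nth_derivative i f y + nth_derivative i g y) has_vector_derivative
            nth_derivative (Suc i) f x + nth_derivative (Suc i) g x) (at x)"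
      unfolding nth_derivative_Suc using Suc.prems
      by (intro has_vector_derivative_add) (simp_all flip: vector_derivative_works)
    then have "vector_derivative (nth_derivative i f + nth_derivative i g) (at x)
        = nth_derivative (Suc i) f x + nth_derivative (Suc i) g x"
      unfolding plus_fun_def by (rule vector_derivative_at)
    then show "nth_derivative (Suc i) (f + g) x
        = (nth_derivative (Suc i) f + nth_derivative (Suc i) g) x"
      unfolding nth_derivative_Suc[of i "f + g"] using Suc by (subst Suc.IH) simp_all
  qed
qed simp

lemma nth_derivative_add_C_infinity:
  assumes "f \<in> C_infinity" "g \<in> C_infinity"
  shows "nth_derivative i (f + g) = nth_derivative i f + nth_derivative i g"
  using assms by (intro nth_derivative_add C_infinity_differentiable)

lemma C_infinity_add:
  assumes "f \<in> C_infinity" "g \<in> C_infinity"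
  shows "f + g \<in> C_infinity"
proof -
  have "nth_derivative i (f + g) differentiable (at x)" for i x
    unfolding nth_derivative_add_C_infinity[OF assms] unfolding plus_fun_def
    using assms by (intro differentiable_add C_infinity_differentiable)
  then show ?thesis
    unfolding C_infinity_def by blast
qed

text \<open>Phrased as an identity of functions rather than at a point, so that the product rule can
  be rewritten under \<open>nth_derivative k\<close>.\<close>

lemma vector_derivative_mult:
  assumes "f \<in> C_infinity" "g \<in> C_infinity"
  shows "(\<lambda>x. vector_derivative (f * g) (at x))
    = f * (\<lambda>x. vector_derivative g (at x)) + (\<lambda>x. vector_derivative f (at x)) * g"
proof
  fix x
  have "((\<lambda>x. f x * g x) has_vector_derivative
          f x * vector_derivative g (at x) + vector_derivative f (at x) * g x) (at x)"
    using C_infinity_differentiable_0[OF assms(1)] C_infinity_differentiable_0[OF assms(2)]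
    by (intro has_vector_derivative_mult) (simp_all flip: vector_derivative_works)
  then show "vector_derivative (f * g) (at x)
    = (f * (\<lambda>x. vector_derivative g (at x)) + (\<lambda>x. vector_derivative f (at x)) * g) x"
    by (simp add: times_fun_def vector_derivative_at)
qed

text \<open>Strong induction on the order, for all smooth pairs at once: one use of the product rule
  turns order \<open>Suc k\<close> of \<open>f * g\<close> into order \<open>k\<close> of two
  products whose factors are again smooth.\<close>

lemma C_infinity_mult:
  assumes "f \<in> C_infinity" "g \<in> C_infinity"
  shows "f * g \<in> C_infinity"
proof -
  have "nth_derivative i (f * g) differentiable (at x)" for i x
    using assms
  proof (induction i arbitrary: f g x rule: less_induct)
    case (less i)
    show ?case
    proof (cases i)
      case 0
      then show ?thesis
        using less.prems C_infinity_differentiable_0 by (simp add: times_fun_def)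
    next
      case (Suc k)
      let ?f' = "\<lambda>x. vector_derivative f (at x)" and ?g' = "\<lambda>x. vector_derivative g (at x)"
      \<comment> \<open>Orders below \<open>k\<close> allow the \<open>k\<close>-th derivative to be
        split over the sum; order \<open>k\<close> itself gives differentiability of the two
        resulting summands.\<close>
      have *: "nth_derivative j (f * ?g') differentiable (at x)"
        "nth_derivative j (?f' * g) differentiable (at x)" if "j \<le> k" for j x
        using that
        by (intro less.IH less.prems C_infinity_vector_derivative; simp add: Suc)+
      have "nth_derivative i (f * g) = nth_derivative k (f * ?g') + nth_derivative k (?f' * g)"
        unfolding Suc nth_derivative_Suc' vector_derivative_mult[OF less.prems]
        by (intro nth_derivative_add *) simp_all
      then show ?thesis
        unfolding plus_fun_def using * by (simp only: differentiable_add order_refl)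
    qed
  qed
  then show ?thesis
    by (simp add: C_infinity_def)
qed

lemma C_infinity_const: "(\<lambda>x. c) \<in> C_infinity"
proof -
  have "nth_derivative i (\<lambda>x. c) differentiable (at x)" for i c x
    by (induction i arbitrary: c) (simp_all add: nth_derivative_Suc')
  then show ?thesis
    by (simp add: C_infinity_def)
qed

lemma fun_scale_apply: "fun_scale c f x = c * f x"
  by (simp add: fun_scale_def)

lemma nth_derivative_scale:
  assumes "f \<in> C_infinity"
  shows "nth_derivative i (fun_scale c f) = fun_scale c (nth_derivative i f)"
proof (induction i)
  case (Suc i)
  show ?case
  proof
    fix x
    have "((\<lambda>y. c * nth_derivative i f y) has_vector_derivative
            c * nth_derivative (Suc i) f x) (at x)"
      unfolding nth_derivative_Suc using C_infinity_differentiable[OF assms]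
      by (intro has_vector_derivative_mult_right) (simp_all flip: vector_derivative_works)
    then have "vector_derivative (fun_scale c (nth_derivative i f)) (at x)
        = c * nth_derivative (Suc i) f x"
      unfolding fun_scale_def by (rule vector_derivative_at)
    then show "nth_derivative (Suc i) (fun_scale c f) x = fun_scale c (nth_derivative (Suc i) f) x"
      by (simp add: nth_derivative_Suc[of i "fun_scale c f"] Suc.IH) (simp add: fun_scale_def)
  qed
qed simp

lemma C_infinity_scale:
  assumes "f \<in> C_infinity"
  shows "fun_scale c f \<in> C_infinity"
  using C_infinity_mult[OF C_infinity_const assms, of c] by (simp add: fun_scale_def times_fun_def)

lemma C_infinity_diff:
  assumes "f \<in> C_infinity" "g \<in> C_infinity"
  shows "f - g \<in> C_infinity"
proof -
  have "f - g = f + fun_scale (-1) g"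
    by (auto simp: fun_scale_def)
  then show ?thesis
    by (metis C_infinity_add C_infinity_scale assms)
qed

lemma C_infinity_zero: "0 \<in> C_infinity"
  using C_infinity_const[of 0] by (simp add: zero_fun_def)

lemma C_infinity_power:
  assumes "f \<in> C_infinity"
  shows "(\<lambda>x. f x ^ n) \<in> C_infinity"
proof (induction n)
  case (Suc n)
  then show ?case
    using C_infinity_mult[OF assms Suc] by (simp add: times_fun_def)
qed (simp add: C_infinity_const)

text \<open>A Leibniz estimate without binomial coefficients: each use of the product rule doubles
  the number of terms, and \<open>A\<close> and \<open>B\<close> dominate every derivative that can
  occur, whence the factor \<open>2 ^ i\<close>.\<close>

lemma nth_derivative_mult_bound:
  assumes "f \<in> C_infinity" "g \<in> C_infinity"
    and "\<And>j. j \<le> i \<Longrightarrow> cmod (nth_derivative j f x) \<le> A"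
    and "\<And>j. j \<le> i \<Longrightarrow> cmod (nth_derivative j g x) \<le> B"
  shows "cmod (nth_derivative i (f * g) x) \<le> 2 ^ i * A * B"
  using assms
proof (induction i arbitrary: f g)
  case 0
  then have "cmod (f x) \<le> A" "cmod (g x) \<le> B"
    using 0(3)[of 0] 0(4)[of 0] by simp_all
  then show ?case
    by (simp add: norm_mult mult_mono')
next
  case (Suc i)
  let ?f' = "\<lambda>x. vector_derivative f (at x)" and ?g' = "\<lambda>x. vector_derivative g (at x)"
  have smooth: "?f' \<in> C_infinity" "?g' \<in> C_infinity"
    using Suc.prems C_infinity_vector_derivative by auto
  \<comment> \<open>Order \<open>j\<close> of a derivative is order \<open>Suc j\<close> of the
    function, so the same \<open>A\<close> and \<open>B\<close> serve in the induction
    hypothesis.\<close>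
  have bounds: "cmod (nth_derivative j ?f' x) \<le> A" "cmod (nth_derivative j ?g' x) \<le> B"
    if "j \<le> i" for j
    using Suc.prems(3)[of "Suc j"] Suc.prems(4)[of "Suc j"] that
    by (simp_all add: nth_derivative_Suc')
  have "nth_derivative (Suc i) (f * g) = nth_derivative i (f * ?g') + nth_derivative i (?f' * g)"
    unfolding nth_derivative_Suc' vector_derivative_mult[OF Suc.prems(1,2)]
    using Suc.prems smooth by (intro nth_derivative_add_C_infinity C_infinity_mult)
  then have "cmod (nth_derivative (Suc i) (f * g) x)
      \<le> cmod (nth_derivative i (f * ?g') x) + cmod (nth_derivative i (?f' * g) x)"
    by (simp add: norm_triangle_ineq)
  also have "\<dots> \<le> 2 ^ i * A * B + 2 ^ i * A * B"
    using Suc.prems smooth bounds by (intro add_mono Suc.IH) simp_all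
  also have "\<dots> = 2 ^ Suc i * A * B"
    by simp
  finally show ?case .
qed

subsection \<open>The seminorms\<close>

lemma C_infinity_seminorm_least:
  assumes "K \<noteq> {}" "\<And>x i. x \<in> K \<Longrightarrow> i \<le> m \<Longrightarrow> cmod (nth_derivative i f x) \<le> B"
  shows "C_infinity_seminorm K m f \<le> B"
  unfolding C_infinity_seminorm_def using assms by (intro cSUP_least) auto

text \<open>A real supremum dominates its members only once it is known to be bounded above. The
  inner one ranges over a finite set; for the outer one the derivatives are continuous, hence
  bounded on the compact set \<open>K\<close>.\<close>

lemma C_infinity_seminorm_upper:
  assumes "f \<in> C_infinity" "compact K" "x \<in> K" "i \<le> m"
  shows "cmod (nth_derivative i f x) \<le> C_infinity_seminorm K m f"
proof -
  let ?s = "\<lambda>x. SUP i\<in>{0..m}. cmod (nth_derivative i f x)"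
  \<comment> \<open>The sum dominates the inner supremum, and its continuity in \<open>x\<close>
    follows directly from that of the summands.\<close>
  let ?b = "\<lambda>x. \<Sum>i\<in>{0..m}. cmod (nth_derivative i f x)"
  have "continuous_on K (nth_derivative i f)" for i
    using C_infinity_differentiable[OF assms(1)]
    by (intro continuous_at_imp_continuous_on ballI differentiable_imp_continuous_within)
  then have "compact (?b ` K)"
    using assms(2) by (intro compact_continuous_image continuous_intros)
  then obtain B where B: "\<And>x. x \<in> K \<Longrightarrow> ?b x \<le> B"
    by (meson bdd_above.E bounded_imp_bdd_above compact_imp_bounded imageI)
  have "?s x \<le> B" if "x \<in> K" for x
  proof -
    have "?s x \<le> ?b x"
      by (intro cSUP_least) (auto intro: member_le_sum)
    with B[OF that] show ?thesis by simp
  qed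
  then have "bdd_above (?s ` K)"
    by (auto intro!: bdd_aboveI2[of _ _ B])
  have "cmod (nth_derivative i f x) \<le> ?s x"
    using assms(4) by (intro cSUP_upper) auto
  also have "\<dots> \<le> C_infinity_seminorm K m f"
    unfolding C_infinity_seminorm_def
    using assms(3) \<open>bdd_above (?s ` K)\<close> by (intro cSUP_upper)
  finally show ?thesis .
qed

lemma C_infinity_seminorm_nonneg:
  assumes "f \<in> C_infinity" "compact K" "K \<noteq> {}"
  shows "0 \<le> C_infinity_seminorm K m f"
  using assms C_infinity_seminorm_upper[of f K _ 0 m] norm_ge_zero order_trans by blast

lemma C_infinity_seminorm_zero:
  assumes "compact K" "K \<noteq> {}"
  shows "C_infinity_seminorm K m 0 = 0"
proof -
  \<comment> \<open>Homogeneity with the scalar \<open>0\<close> shows that all derivatives of the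
    zero function vanish.\<close>
  have "fun_scale 0 0 = 0"
    by (auto simp: fun_scale_def)
  then have "nth_derivative i 0 = 0" for i
    using nth_derivative_scale[OF C_infinity_zero, of i 0] by (auto simp: fun_scale_def)
  then have "C_infinity_seminorm K m 0 \<le> 0"
    using assms by (intro C_infinity_seminorm_least) simp_all
  then show ?thesis
    using C_infinity_seminorm_nonneg[OF C_infinity_zero assms, of m] by simp
qed

text \<open>Makes the family of seminorms directed: any two are dominated by the one for the union
  of the compact sets and the larger order.\<close>

lemma C_infinity_seminorm_mono:
  assumes "f \<in> C_infinity" "compact L" "K \<noteq> {}" "K \<subseteq> L" "k \<le> l"
  shows "C_infinity_seminorm K k f \<le> C_infinity_seminorm L l f"
  using assms by (intro C_infinity_seminorm_least C_infinity_seminorm_upper) auto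

lemma C_infinity_seminorm_add:
  assumes "f \<in> C_infinity" "g \<in> C_infinity" "compact K" "K \<noteq> {}"
  shows "C_infinity_seminorm K m (f + g) \<le> C_infinity_seminorm K m f + C_infinity_seminorm K m g"
proof (rule C_infinity_seminorm_least)
  fix x i assume "x \<in> K" "i \<le> m"
  have "cmod (nth_derivative i (f + g) x) \<le> cmod (nth_derivative i f x) + cmod (nth_derivative i g x)"
    by (simp add: nth_derivative_add_C_infinity[OF assms(1,2)] norm_triangle_ineq)
  also have "\<dots> \<le> C_infinity_seminorm K m f + C_infinity_seminorm K m g"
    using assms \<open>x \<in> K\<close> \<open>i \<le> m\<close> by (intro add_mono C_infinity_seminorm_upper)
  finally show "cmod (nth_derivative i (f + g) x)
    \<le> C_infinity_seminorm K m f + C_infinity_seminorm K m g" .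
qed (fact assms)

lemma C_infinity_seminorm_scale_le:
  assumes "f \<in> C_infinity" "compact K" "K \<noteq> {}"
  shows "C_infinity_seminorm K m (fun_scale c f) \<le> cmod c * C_infinity_seminorm K m f"
proof (rule C_infinity_seminorm_least)
  fix x i assume "x \<in> K" "i \<le> m"
  then show "cmod (nth_derivative i (fun_scale c f) x) \<le> cmod c * C_infinity_seminorm K m f"
    using assms unfolding nth_derivative_scale[OF assms(1)]
    by (simp add: fun_scale_apply norm_mult mult_left_mono C_infinity_seminorm_upper)
qed (fact assms)

lemma C_infinity_seminorm_mult:
  assumes "f \<in> C_infinity" "g \<in> C_infinity" "compact K" "K \<noteq> {}"
  shows "C_infinity_seminorm K m (f * g)
    \<le> 2 ^ m * C_infinity_seminorm K m f * C_infinity_seminorm K m g"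
proof (rule C_infinity_seminorm_least)
  fix x i assume "x \<in> K" "i \<le> m"
  have "cmod (nth_derivative i (f * g) x)
      \<le> 2 ^ i * C_infinity_seminorm K m f * C_infinity_seminorm K m g"
    using assms \<open>x \<in> K\<close> \<open>i \<le> m\<close>
    by (intro nth_derivative_mult_bound C_infinity_seminorm_upper) simp_all
  also have "\<dots> \<le> 2 ^ m * C_infinity_seminorm K m f * C_infinity_seminorm K m g"
    using assms \<open>i \<le> m\<close>
    by (intro mult_right_mono power_increasing C_infinity_seminorm_nonneg) simp_all
  finally show "cmod (nth_derivative i (f * g) x)
    \<le> 2 ^ m * C_infinity_seminorm K m f * C_infinity_seminorm K m g" .
qed (fact assms)

subsection \<open>The topology\<close>

lemma openin_C_infinity_ball:
  assumes "f \<in> C_infinity" "compact K" "K \<noteq> {}" "0 < r"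
  shows "openin C_infinity_top {g \<in> C_infinity. C_infinity_seminorm K m (g - f) < r}"
  unfolding C_infinity_top_def seminorm_topology_def
  by (rule topology_generated_by_Basis) (use assms in blast)

text \<open>The topology is generated by balls as a subbasis. Since the seminorms are directed and
  balls can be recentred, single balls around \<open>f\<close> already form a neighbourhood base at
  \<open>f\<close>; the proof follows the generation of open sets.\<close>

lemma C_infinity_nhdE:
  assumes "openin C_infinity_top U" "f \<in> U"
  obtains K m r where "compact K" "K \<noteq> {}" "0 < r"
    "{g \<in> C_infinity. C_infinity_seminorm K m (g - f) < r} \<subseteq> U"
proof -
  let ?ball = "\<lambda>K m r. {g \<in> C_infinity. C_infinity_seminorm K m (g - f) < r}"
  let ?B = "{{g \<in> C_infinity. p (g - f) < r} | p f r.
    p \<in> {C_infinity_seminorm K m | K m. compact K \<and> K \<noteq> {}} \<and> f \<in> C_infinity \<and> r > 0}"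
  have "f \<in> C_infinity"
    using assms openin_subset topspace_C_infinity_top by blast
  have "generate_topology_on ?B U"
    using assms(1) by (simp add: C_infinity_top_def seminorm_topology_def openin_topology_generated_by)
  then have "\<exists>K m r. compact K \<and> K \<noteq> {} \<and> 0 < r \<and> ?ball K m r \<subseteq> U"
    using assms(2)
  proof induction
    case Empty
    then show ?case by simp
  next
    case (Int U V)
    then have "f \<in> U" "f \<in> V"
      by simp_all
    from Int.IH(1)[OF this(1)] obtain K m r
      where K: "compact K" "K \<noteq> {}" "0 < r" "?ball K m r \<subseteq> U"
      by (elim exE conjE) (rule that)
    from Int.IH(2)[OF \<open>f \<in> V\<close>] obtain L n s
      where L: "compact L" "L \<noteq> {}" "0 < s" "?ball L n s \<subseteq> V"
      by (elim exE conjE) (rule that)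
    have "g \<in> U \<inter> V" if g: "g \<in> ?ball (K \<union> L) (max m n) (min r s)" for g
    proof -
      have "g - f \<in> C_infinity"
        using g \<open>f \<in> C_infinity\<close> by (simp add: C_infinity_diff)
      then have "C_infinity_seminorm K m (g - f) \<le> C_infinity_seminorm (K \<union> L) (max m n) (g - f)"
        "C_infinity_seminorm L n (g - f) \<le> C_infinity_seminorm (K \<union> L) (max m n) (g - f)"
        using K L by (auto intro!: C_infinity_seminorm_mono)
      then show ?thesis
        using K(4) L(4) g by force
    qed
    then have "?ball (K \<union> L) (max m n) (min r s) \<subseteq> U \<inter> V"
      by blast
    moreover have "compact (K \<union> L)" "K \<union> L \<noteq> {}" "0 < min r s"
      using K L by (simp_all add: compact_Un)
    ultimately show ?case
      by (intro exI[of _ "K \<union> L"] exI[of _ "max m n"] exI[of _ "min r s"] conjI)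
  next
    case (UN \<U>)
    then obtain S where S: "S \<in> \<U>" "f \<in> S"
      by auto
    from UN.IH[OF S] S(1) show ?case
      by (meson Union_upper order_trans)
  next
    case (Basis S)
    then obtain K m e r where K: "compact K" "K \<noteq> {}" and "e \<in> C_infinity"
      and S: "S = {g \<in> C_infinity. C_infinity_seminorm K m (g - e) < r}"
      by blast
    \<comment> \<open>The subbasic ball is centred at \<open>e\<close>, not at \<open>f\<close>. The
      triangle inequality leaves this radius around \<open>f\<close>, positive because
      \<open>f\<close> lies in the ball.\<close>
    let ?d = "r - C_infinity_seminorm K m (f - e)"
    have "g \<in> S" if g: "g \<in> ?ball K m ?d" for g
    proof -
      have "g - f \<in> C_infinity" "f - e \<in> C_infinity"
        using g \<open>f \<in> C_infinity\<close> \<open>e \<in> C_infinity\<close> by (simp_all add: C_infinity_diff)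
      then have "C_infinity_seminorm K m ((g - f) + (f - e))
          \<le> C_infinity_seminorm K m (g - f) + C_infinity_seminorm K m (f - e)"
        using K by (rule C_infinity_seminorm_add)
      then show ?thesis
        using g S by simp
    qed
    moreover have "0 < ?d"
      using S Basis.prems by simp
    ultimately show ?case
      using K by blast
  qed
  then show ?thesis
    using that by blast
qed

text \<open>If the open unit ball of the seminorm, scaled by \<open>t\<close>, covers
  \<open>B\<close>, then the seminorm is at most \<open>t\<close> on \<open>B\<close> by
  homogeneity.\<close>

lemma vn_bounded_C_infinity_seminorm:
  assumes "vn_bounded fun_scale C_infinity_top B" "compact K" "K \<noteq> {}"
  obtains C where "0 \<le> C" "\<forall>f\<in>B. C_infinity_seminorm K m f \<le> C"
proof -
  let ?U = "{g \<in> C_infinity. C_infinity_seminorm K m (g - 0) < 1}"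
  have "openin C_infinity_top ?U" "0 \<in> ?U"
    using assms openin_C_infinity_ball[OF C_infinity_zero, of K 1 m]
    by (simp_all add: C_infinity_zero C_infinity_seminorm_zero)
  then obtain s where s: "s > 0" "\<And>t. t > s \<Longrightarrow> B \<subseteq> fun_scale (complex_of_real t) ` ?U"
    using assms(1) unfolding vn_bounded_def by blast
  \<comment> \<open>Absorption is granted only for scalars strictly beyond \<open>s\<close>.\<close>
  define t where "t = s + 1"
  have t: "t > s" "t > 0"
    using s(1) by (simp_all add: t_def)
  have "C_infinity_seminorm K m f \<le> t" if "f \<in> B" for f
  proof -
    obtain u where u: "u \<in> C_infinity" "C_infinity_seminorm K m u < 1"
      "f = fun_scale (complex_of_real t) u"
      using s(2)[OF t(1)] \<open>f \<in> B\<close> by auto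
    then have "C_infinity_seminorm K m f \<le> t * C_infinity_seminorm K m u"
      using C_infinity_seminorm_scale_le[OF u(1) assms(2,3), of m "complex_of_real t"] t(2)
      by simp
    also have "\<dots> \<le> t"
      using u(2) t(2) by (intro mult_left_le) simp_all
    finally show ?thesis .
  qed
  with t(2) that[of t] show thesis by simp
qed

subsection \<open>Multiplication operators\<close>

lemma mult_operator_eq_times: "mult_operator h f = h * f"
  by (simp add: mult_operator_def times_fun_def)

lemma funpow_mult_operator: "(mult_operator h ^^ n) f = (\<lambda>x. h x ^ n) * f"
  by (induction n) (auto simp: mult_operator_def mult.assoc)

text \<open>Submultiplicativity bounds the seminorm of \<open>h * (g - f)\<close> by a constant
  times the same seminorm of \<open>g - f\<close>; this makes the preimage of an open set a
  neighbourhood of each of its points.\<close>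

lemma mult_operator_continuous_operators:
  assumes "h \<in> C_infinity"
  shows "mult_operator h \<in> continuous_operators fun_scale C_infinity_top"
proof -
  have "continuous_map C_infinity_top C_infinity_top (mult_operator h)"
    unfolding continuous_map topspace_C_infinity_top
  proof safe
    fix f assume "f \<in> C_infinity"
    then show "mult_operator h f \<in> C_infinity"
      using assms by (simp add: mult_operator_eq_times C_infinity_mult)
  next
    fix U assume U: "openin C_infinity_top U"
    show "openin C_infinity_top {f \<in> C_infinity. mult_operator h f \<in> U}"
    proof (subst openin_subopen, safe)
      fix f assume f: "f \<in> C_infinity" "mult_operator h f \<in> U"
      obtain K m r where K: "compact K" "K \<noteq> {}" "0 < r"
        and r: "{g \<in> C_infinity. C_infinity_seminorm K m (g - mult_operator h f) < r} \<subseteq> U"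
        by (rule C_infinity_nhdE[OF U f(2)])
      \<comment> \<open>The summand \<open>1\<close> keeps the radius \<open>r / c\<close>
        meaningful when the seminorm of \<open>h\<close> vanishes.\<close>
      define c where "c = 2 ^ m * C_infinity_seminorm K m h + 1"
      have "c > 0"
        using C_infinity_seminorm_nonneg[OF assms K(1,2), of m] by (simp add: c_def add_nonneg_pos)
      let ?V = "{g \<in> C_infinity. C_infinity_seminorm K m (g - f) < r / c}"
      have "mult_operator h g \<in> U" if g: "g \<in> ?V" for g
      proof -
        have "g - f \<in> C_infinity"
          using g f by (simp add: C_infinity_diff)
        have "C_infinity_seminorm K m (h * g - h * f) = C_infinity_seminorm K m (h * (g - f))"
          by (rule arg_cong[of _ _ "C_infinity_seminorm K m"]) (auto simp: algebra_simps)
        also have "\<dots> \<le> 2 ^ m * C_infinity_seminorm K m h * C_infinity_seminorm K m (g - f)"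
          using assms \<open>g - f \<in> C_infinity\<close> K(1,2) by (rule C_infinity_seminorm_mult)
        also have "\<dots> \<le> c * C_infinity_seminorm K m (g - f)"
          using C_infinity_seminorm_nonneg[OF \<open>g - f \<in> C_infinity\<close> K(1,2), of m]
          by (simp add: c_def mult_right_mono)
        also have "\<dots> < r"
          using g \<open>c > 0\<close> by (simp add: field_simps)
        finally show ?thesis
          using r g C_infinity_mult[OF assms, of g] by (auto simp: mult_operator_eq_times)
      qed
      moreover have "openin C_infinity_top ?V" "f \<in> ?V"
        using openin_C_infinity_ball[OF f(1) K(1,2), of "r / c" m] f K \<open>c > 0\<close>
        by (simp_all add: C_infinity_seminorm_zero)
      ultimately show "\<exists>V. openin C_infinity_top V \<and> f \<in> V
          \<and> V \<subseteq> {f \<in> C_infinity. mult_operator h f \<in> U}"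
        by (intro exI[of _ ?V]) auto
    qed
  qed
  then show ?thesis
    by (auto simp: continuous_operators_def mult_operator_def fun_scale_def algebra_simps)
qed

text \<open>The fixed \<open>f\<close> is made the multiplier and the mean of the powers of
  \<open>h\<close> the argument, so that continuity of \<open>mult_operator f\<close> can carry a
  limit of these means over to the operators. At \<open>n = 0\<close> both sides vanish, as
  \<open>1 / 0 = 0\<close>.\<close>

lemma cesaro_mean_mult_operator:
  "cesaro_mean fun_scale (mult_operator h) n f
    = mult_operator f (\<lambda>x. (1 / of_nat n) * (\<Sum>m = 1..n. h x ^ m))"
proof -
  have "(\<Sum>m\<in>A. (mult_operator h ^^ m) f) x = (\<Sum>m\<in>A. h x ^ m) * f x" for A x
    by (induction A rule: infinite_finite_induct)
      (simp_all add: funpow_mult_operator distrib_right)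
  then show ?thesis
    by (auto simp: cesaro_mean_def fun_scale_def mult_operator_def mult_ac)
qed

text \<open>Forward, the operator powers are applied to a small constant function and the result is
  scaled back. Backward, a uniform seminorm bound on the powers of \<open>h\<close> gives one
  neighbourhood for all operator powers.\<close>

lemma power_bounded_mult_operator_iff:
  assumes "h \<in> C_infinity"
  shows "power_bounded fun_scale C_infinity_top (mult_operator h) \<longleftrightarrow>
    vn_bounded fun_scale C_infinity_top {\<lambda>x. h x ^ n | n. n \<ge> 1}"
proof
  assume T: "power_bounded fun_scale C_infinity_top (mult_operator h)"
  show "vn_bounded fun_scale C_infinity_top {\<lambda>x. h x ^ n | n. n \<ge> 1}"
    unfolding vn_bounded_def
  proof safe
    fix U :: "(real \<Rightarrow> complex) set" assume "openin C_infinity_top U" "0 \<in> U"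
    then obtain V where V: "openin C_infinity_top V" "0 \<in> V"
      and "\<forall>S\<in>{mult_operator h ^^ n | n. n \<ge> 1}. S ` V \<subseteq> U"
      using T unfolding power_bounded_def equicontinuous_family_def by meson
    then have VU: "(mult_operator h ^^ n) f \<in> U" if "n \<ge> 1" "f \<in> V" for n f
      using that by blast
    obtain K m r where K: "compact K" "K \<noteq> {}" "0 < r"
      and r: "{g \<in> C_infinity. C_infinity_seminorm K m (g - 0) < r} \<subseteq> V"
      by (rule C_infinity_nhdE[OF V])
    define c where "c = C_infinity_seminorm K m (\<lambda>x. 1)"
    have "c \<ge> 0"
      using C_infinity_seminorm_nonneg[OF C_infinity_const K(1,2)] by (simp add: c_def)
    show "\<exists>s>0. \<forall>t>s. {\<lambda>x. h x ^ n | n. n \<ge> 1} \<subseteq> fun_scale (complex_of_real t) ` U"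
    \<comment> \<open>For \<open>t\<close> beyond this threshold the constant function
      \<open>1 / t\<close> has seminorm at most \<open>c / t < r\<close> and so lies in
      \<open>V\<close>. Only \<open>c \<ge> 0\<close> has been shown, so the added \<open>1\<close>
      secures positivity.\<close>
    proof (intro exI[of _ "(c + 1) / r"] conjI allI impI subsetI)
      show "(c + 1) / r > 0"
        using \<open>c \<ge> 0\<close> K(3) by (simp add: add_nonneg_pos)
      fix t f assume t: "(c + 1) / r < t" and "f \<in> {\<lambda>x. h x ^ n | n. n \<ge> 1}"
      then obtain n where n: "n \<ge> 1" "f = (\<lambda>x. h x ^ n)" by auto
      have "t > 0"
        using t \<open>(c + 1) / r > 0\<close> by linarith
      let ?u = "fun_scale (complex_of_real (1 / t)) (\<lambda>x. 1)"
      have "C_infinity_seminorm K m ?u \<le> cmod (complex_of_real (1 / t)) * c"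
        unfolding c_def using C_infinity_const K(1,2) by (rule C_infinity_seminorm_scale_le)
      also have "\<dots> = c / t"
        using \<open>t > 0\<close> by (simp only: norm_of_real) simp
      also have "\<dots> < r"
        using t \<open>t > 0\<close> K(3) by (simp add: field_simps)
      finally have "?u \<in> V"
        using r C_infinity_scale[OF C_infinity_const] by auto
      then have "(mult_operator h ^^ n) ?u \<in> U"
        by (rule VU[OF n(1)])
      moreover have "f = fun_scale (complex_of_real t) ((mult_operator h ^^ n) ?u)"
        using \<open>t > 0\<close> by (auto simp: n fun_scale_def funpow_mult_operator)
      ultimately show "f \<in> fun_scale (complex_of_real t) ` U"
        by blast
    qed
  qed
next
  assume B: "vn_bounded fun_scale C_infinity_top {\<lambda>x. h x ^ n | n. n \<ge> 1}"
  have "equicontinuous_family C_infinity_top {mult_operator h ^^ n | n. n \<ge> 1}"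
    unfolding equicontinuous_family_def
  proof (intro allI impI)
    fix U :: "(real \<Rightarrow> complex) set" assume "openin C_infinity_top U \<and> 0 \<in> U"
    then have U: "openin C_infinity_top U" "0 \<in> U"
      by simp_all
    obtain K m r where K: "compact K" "K \<noteq> {}" "0 < r"
      and r: "{g \<in> C_infinity. C_infinity_seminorm K m (g - 0) < r} \<subseteq> U"
      by (rule C_infinity_nhdE[OF U])
    obtain C where "0 \<le> C" and bound:
      "\<forall>f\<in>{\<lambda>x. h x ^ n | n. n \<ge> 1}. C_infinity_seminorm K m f \<le> C"
      by (rule vn_bounded_C_infinity_seminorm[OF B K(1,2), of m])
    have C: "C_infinity_seminorm K m (\<lambda>x. h x ^ n) \<le> C" if "n \<ge> 1" for n
      using that by (intro bspec[OF bound]) blast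
    \<comment> \<open>As \<open>C\<close> does not depend on \<open>n\<close>, the radius
      \<open>r / c\<close> serves every power at once; the summand \<open>1\<close> again ensures
      positivity.\<close>
    define c where "c = 2 ^ m * C + 1"
    have "c > 0"
      using \<open>0 \<le> C\<close> by (simp add: c_def add_nonneg_pos)
    let ?V = "{g \<in> C_infinity. C_infinity_seminorm K m (g - 0) < r / c}"
    have "(mult_operator h ^^ n) f \<in> U" if n: "n \<ge> 1" and f: "f \<in> ?V" for n f
    proof -
      let ?p = "\<lambda>x. h x ^ n"
      have p: "?p \<in> C_infinity"
        using assms by (rule C_infinity_power)
      have nonneg: "0 \<le> C_infinity_seminorm K m f"
        using f K by (simp add: C_infinity_seminorm_nonneg)
      have "C_infinity_seminorm K m (?p * f)
          \<le> 2 ^ m * C_infinity_seminorm K m ?p * C_infinity_seminorm K m f"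
        using f K p by (intro C_infinity_seminorm_mult) simp_all
      also have "\<dots> \<le> c * C_infinity_seminorm K m f"
        using C[OF n] nonneg by (intro mult_right_mono) (simp_all add: c_def add_increasing2)
      also have "\<dots> < r"
        using f \<open>c > 0\<close> by (simp add: field_simps)
      finally show ?thesis
        using r f C_infinity_mult[OF p, of f] by (auto simp: funpow_mult_operator)
    qed
    moreover have "openin C_infinity_top ?V" "0 \<in> ?V"
      using openin_C_infinity_ball[OF C_infinity_zero K(1,2), of "r / c" m] K \<open>c > 0\<close>
      by (simp_all add: C_infinity_zero C_infinity_seminorm_zero)
    ultimately show "\<exists>V. openin C_infinity_top V \<and> 0 \<in> V
        \<and> (\<forall>T\<in>{mult_operator h ^^ n | n. n \<ge> 1}. T ` V \<subseteq> U)"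
      by (intro exI[of _ ?V]) auto
  qed
  then show "power_bounded fun_scale C_infinity_top (mult_operator h)"
    by (simp add: power_bounded_def mult_operator_continuous_operators assms)
qed

text \<open>Evaluating the Cesaro means at the constant function \<open>1\<close> returns the means
  of the powers of \<open>h\<close>, with limit \<open>P 1\<close>. Conversely, a limit
  \<open>g\<close> of those means yields the limit operator \<open>mult_operator g\<close>.\<close>

lemma mean_ergodic_mult_operator_iff:
  assumes "h \<in> C_infinity"
  shows "mean_ergodic fun_scale C_infinity_top (mult_operator h) \<longleftrightarrow>
    (\<exists>g. limitin C_infinity_top
           (\<lambda>n x. (1 / of_nat n) * (\<Sum>m = 1..n. h x ^ m)) g sequentially)"
    (is "_ \<longleftrightarrow> (\<exists>g. limitin _ ?h g _)")
proof
  assume "mean_ergodic fun_scale C_infinity_top (mult_operator h)"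
  then obtain P :: "(real \<Rightarrow> complex) \<Rightarrow> real \<Rightarrow> complex"
    where "limitin C_infinity_top
      (\<lambda>n. cesaro_mean fun_scale (mult_operator h) n (\<lambda>x. 1)) (P (\<lambda>x. 1)) sequentially"
    using C_infinity_const[of 1] unfolding mean_ergodic_def topspace_C_infinity_top by blast
  then show "\<exists>g. limitin C_infinity_top ?h g sequentially"
    by (auto simp: cesaro_mean_mult_operator mult_operator_def)
next
  assume "\<exists>g. limitin C_infinity_top ?h g sequentially"
  then obtain g where g: "limitin C_infinity_top ?h g sequentially" ..
  \<comment> \<open>Limits in a topology lie in its carrier, so \<open>g\<close> is smooth and
    \<open>mult_operator g\<close> is a continuous operator.\<close>
  then have "g \<in> C_infinity"
    by (metis limitin_topspace topspace_C_infinity_top)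
  have "limitin C_infinity_top (\<lambda>n. cesaro_mean fun_scale (mult_operator h) n f)
      (mult_operator g f) sequentially" if "f \<in> C_infinity" for f
  proof -
    \<comment> \<open>By commutativity the roles are exchanged: the continuous map is multiplication
      by \<open>f\<close>, applied to the sequence converging to \<open>g\<close>.\<close>
    have "continuous_map C_infinity_top C_infinity_top (mult_operator f)"
      using mult_operator_continuous_operators[OF that] by (simp add: continuous_operators_def)
    from continuous_map_limit[OF this g] show ?thesis
      by (simp add: cesaro_mean_mult_operator o_def mult_operator_eq_times mult.commute)
  qed
  then show "mean_ergodic fun_scale C_infinity_top (mult_operator h)"
    unfolding mean_ergodic_def topspace_C_infinity_top
    using mult_operator_continuous_operators assms \<open>g \<in> C_infinity\<close> by blast
qed

theorem proposition4p5:
  fixes h :: "real \<Rightarrow> complex"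
  assumes "h \<in> C_infinity"
  shows "(power_bounded fun_scale C_infinity_top (mult_operator h) \<longleftrightarrow>
            vn_bounded fun_scale C_infinity_top {\<lambda>x. h x ^ n | n. n \<ge> 1}) \<and>
         (mean_ergodic fun_scale C_infinity_top (mult_operator h) \<longleftrightarrow>
            (\<exists>g. limitin C_infinity_top
                   (\<lambda>n x. (1 / of_nat n) * (\<Sum>m = 1..n. h x ^ m)) g sequentially))"
  using power_bounded_mult_operator_iff[OF assms] mean_ergodic_mult_operator_iff[OF assms] by blast

end
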